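(* Let $A\in\mathbb{R}^{n\times n}$ and let $$\bar A=\begin{pmatrix} O & A^T\\ A & O\end{pmatrix}\in\mathbb{R}^{2n\times 2n}.$$ Let $\theta\in\mathbb{R}$, let $\widehat L\in\mathbb{R}^{2n\times 2n}$, and let $\widehat D\in\mathbb{R}^{2n\times 2n}$ be symmetric. Let $\rho\in\mathbb{R}$ satisfy $$\rho\ \geq\ \|\bar A+\theta I-\widehat L\widehat D\widehat L^T\|.$$ If the number of positive eigenvalues of $\widehat D$ is equal to $n$, or the number of negative eigenvalues of $\widehat D$ is equal to $n$, then $$\sigma_{\min}(A)\ \geq\ |\theta|-\rho.$$ In particular, if moreover $|\theta|>\rho$, then $A$ is nonsingular and $$\|A^{-1}\|\ \leq\ \frac{1}{|\theta|-\rho}.$$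
   Context: $\|\cdot\|$ denotes the $L^2$ operator norm (spectral norm) of a matrix. $\sigma_{\min}(A)$ denotes the smallest singular value of $A$, i.e. the minimum of the $n$ singular values $\sigma_1,\dots,\sigma_n\geq 0$ of $A$. $I$ is the identity matrix of the appropriate size (here $2n\times 2n$) and $O$ is the $n\times n$ zero matrix. Eigenvalues are counted with multiplicity. *)

theory Defs
  imports "HOL-Analysis.Analysis"
begin

definition charpoly :: "real^'n^'n \<Rightarrow> real poly" where
  "charpoly A = det (mat [:0, 1:] - map_matrix (\<lambda>a. [:a:]) A)"

definition eigenvalues :: "real^'n^'n \<Rightarrow> real multiset" where
  "eigenvalues A = proots (charpoly A)"

text \<open>
  The definition of \<^term>\<open>eigenvalues\<close> records the real eigenvalues with their algebraic
  multiplicities. Below it is only applied to symmetric matrices, all of whose eigenvalues are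
  real and have equal algebraic and geometric multiplicities.
\<close>

definition num_pos_eigenvalues :: "real^'n^'n \<Rightarrow> nat" where
  "num_pos_eigenvalues A = size (filter_mset (\<lambda>x. x > 0) (eigenvalues A))"

definition num_neg_eigenvalues :: "real^'n^'n \<Rightarrow> nat" where
  "num_neg_eigenvalues A = size (filter_mset (\<lambda>x. x < 0) (eigenvalues A))"

definition singular_values :: "real^'n^'n \<Rightarrow> real multiset" where
  "singular_values A = image_mset sqrt (eigenvalues (transpose A ** A))"

definition sigma_min :: "real^'n^'n \<Rightarrow> real" where
  "sigma_min A = Min (set_mset (singular_values A))"

definition spectral_norm :: "real^'n^'m \<Rightarrow> real" where
  "spectral_norm A = onorm (\<lambda>x. A *v x)"

text \<open>
  Block matrices are indexed by sum types: \<^term>\<open>Inl\<close> indices come first, \<^term>\<open>Inr\<close> indices second,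
  so that \<open>block_matrix P Q R S\<close> has block rows \<open>(P, Q)\<close> and \<open>(R, S)\<close>.
\<close>

definition block_matrix ::
  "'a^'n^'m \<Rightarrow> 'a^'q^'m \<Rightarrow> 'a^'n^'p \<Rightarrow> 'a^'q^'p \<Rightarrow> 'a^('n + 'q)^('m + 'p)" where
  "block_matrix P Q R S = (\<chi> i j.
     case i of
       Inl k \<Rightarrow> (case j of Inl l \<Rightarrow> P $ k $ l | Inr l \<Rightarrow> Q $ k $ l)
     | Inr k \<Rightarrow> (case j of Inl l \<Rightarrow> R $ k $ l | Inr l \<Rightarrow> S $ k $ l))"

definition bar_matrix :: "real^'n^'n \<Rightarrow> real^('n + 'n)^('n + 'n)" where
  "bar_matrix A = block_matrix 0 (transpose A) A 0"

lemma poly_charpoly: "poly (charpoly A) x = det (mat x - A)"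
proof -
  have *: "poly ((mat [:0, 1:] - map_matrix (\<lambda>a. [:a:]) A) $ i $ j) x = (mat x - A) $ i $ j" for i j
    by (simp add: mat_def)
  show ?thesis
    unfolding charpoly_def det_def
    by (simp add: poly_sum poly_prod * del: vector_minus_component)
qed

lemma poly_charpoly_eq_0_iff:
  fixes A :: "real^'n^'n"
  shows "poly (charpoly A) x = 0 \<longleftrightarrow> (\<exists>v. v \<noteq> 0 \<and> A *v v = x *\<^sub>R v)"
proof -
  have "poly (charpoly A) x = 0 \<longleftrightarrow> \<not> invertible (mat x - A)"
    by (simp add: poly_charpoly invertible_det_nz)
  also have "\<dots> \<longleftrightarrow> (\<exists>v. v \<noteq> 0 \<and> (mat x - A) *v v = 0)"
    unfolding invertible_left_inverse matrix_left_invertible_ker by blast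
  also have "(\<lambda>v. (mat x - A) *v v = 0) = (\<lambda>v. A *v v = x *\<^sub>R v)"
  proof
    fix v :: "real^'n"
    have "mat x *v v = x *\<^sub>R v"
      by (simp add: vec_eq_iff matrix_vector_mult_def mat_def if_distrib[of "\<lambda>c. c * _"] cong: if_cong)
    then show "((mat x - A) *v v = 0) = (A *v v = x *\<^sub>R v)"
      by (auto simp: matrix_vector_mult_diff_rdistrib)
  qed
  finally show ?thesis by meson
qed

lemma charpoly_nonzero:
  fixes A :: "real^'n^'n"
  shows "charpoly A \<noteq> 0"
proof
  assume "charpoly A = 0"
  let ?K = "onorm (\<lambda>v. A *v v)"
  have bl: "bounded_linear (\<lambda>v. A *v v)"
    by (rule matrix_vector_mul_bounded_linear)
  obtain v where v: "v \<noteq> 0" "A *v v = (?K + 1) *\<^sub>R v"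
    using poly_charpoly_eq_0_iff[of A "?K + 1"] \<open>charpoly A = 0\<close> by auto
  have "(?K + 1) * norm v \<le> ?K * norm v"
    using onorm[OF bl, of v] onorm_pos_le[OF bl] v by simp
  with v show False by (simp add: algebra_simps)
qed

lemma in_eigenvalues_iff:
  "x \<in># eigenvalues A \<longleftrightarrow> (\<exists>v. v \<noteq> 0 \<and> A *v v = x *\<^sub>R v)"
  by (simp add: eigenvalues_def charpoly_nonzero poly_charpoly_eq_0_iff)

end

theory Submission
  imports Defs
begin

text \<open>
  The theorem is an eigenvalue perturbation bound combined with one half of the law of inertia. The
  bordered matrix of \<open>A\<close> has the eigenvalues \<open>\<sigma>\<close> and \<open>- \<sigma>\<close> for each singular value \<open>\<sigma>\<close>, so
  after the shift by \<open>\<theta>\<close> its \<open>n + 1\<close> largest eigenvalues are all at least \<open>\<theta> - \<sigma>\<close>, where \<open>\<sigma>\<close> is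
  the smallest singular value. On the other hand \<open>L ** D ** transpose L\<close> has no more positive
  eigenvalues than \<open>D\<close>, that is, at most \<open>n\<close> of them. If \<open>\<theta> - \<sigma>\<close> were larger than \<open>\<rho>\<close>, a
  perturbation of norm at most \<open>\<rho>\<close> would leave \<open>n + 1\<close> positive eigenvalues.

  The proof phrases all of this through quadratic forms on subspaces, which replaces the
  Courant--Fischer and Weyl inequalities and the singular value decomposition. A singular pair
  \<open>(v, y)\<close> for \<open>\<sigma>\<close> yields the explicit space of all vectors \<open>(u, A *v u + b *\<^sub>R y)\<close>. It has dimension
  \<open>n + 1\<close>, and the form of the bordered matrix on it is at least \<open>- \<sigma>\<close> times the squared norm
  (\<open>bar_matrix_form_ge\<close>). Pushing this space forward by \<open>transpose L\<close> gives a space of the same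
  dimension on which \<open>D\<close> is positive (\<open>singular_value_ge\<close>). By the spectral theorem, such a space
  cannot be larger than the number of positive eigenvalues counted with algebraic multiplicity
  (\<open>dim_positive_subspace_le\<close>).

  This gives \<open>\<theta> - \<rho>\<close> as a lower bound; changing the signs of \<open>A\<close>, \<open>\<theta>\<close> and \<open>D\<close> gives
  \<open>- \<theta> - \<rho>\<close>. The bound for the inverse follows because the smallest singular value is the least
  factor by which \<open>A\<close> stretches a vector (\<open>least_singular_value\<close>).
\<close>

section \<open>The spectral theorem for symmetric matrices\<close>

text \<open>
  The minimum of the Rayleigh quotient over the unit sphere of \<open>S\<close> is attained by compactness,
  and stationarity at a minimiser is the eigenvector equation. Allowing an invariant subspace
  instead of the whole space is what lets the spectral theorem proceed by induction; the extremality
  of the eigenvalue is needed for the least singular value.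
\<close>

lemma selfadjoint_min_eigenvector:
  fixes f :: "'a::euclidean_space \<Rightarrow> 'a"
  assumes lin: "linear f" and sa: "\<And>x y. f x \<bullet> y = x \<bullet> f y"
    and S: "subspace S" "S \<noteq> {0}" and inv: "f ` S \<subseteq> S"
  obtains v l where "v \<in> S" "norm v = 1" "f v = l *\<^sub>R v"
    and "\<And>x. x \<in> S \<Longrightarrow> l * (x \<bullet> x) \<le> x \<bullet> f x"
proof -
  interpret f: linear f by (rule lin)
  let ?K = "S \<inter> sphere 0 1"
  have unit: "x /\<^sub>R norm x \<in> ?K" if "x \<in> S" "x \<noteq> 0" for x
    using that S by (simp add: subspace_scale)
  have "compact ?K"
    using closed_subspace[OF S(1)] compact_sphere by (simp add: closed_Int_compact)
  moreover have "?K \<noteq> {}"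
    using S unit subspace_0[OF S(1)] by fast
  moreover have "continuous_on ?K (\<lambda>x. x \<bullet> f x)"
    by (intro continuous_intros linear_continuous_on linear_conv_bounded_linear[THEN iffD1] lin)
  ultimately obtain v where v: "v \<in> ?K" and min: "\<And>x. x \<in> ?K \<Longrightarrow> v \<bullet> f v \<le> x \<bullet> f x"
    using continuous_attains_inf[of ?K "\<lambda>x. x \<bullet> f x"] by metis
  define l where "l = v \<bullet> f v"
  have ge: "l * (x \<bullet> x) \<le> x \<bullet> f x" if "x \<in> S" for x
  proof (cases "x = 0")
    case False
    from min[OF unit[OF that False]] have "l \<le> (x \<bullet> f x) / (norm x)\<^sup>2"
      by (simp add: l_def f.scaleR power2_eq_square field_simps)
    then show ?thesis
      using False by (simp add: field_simps dot_square_norm)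
  qed (simp add: f.zero)
  define w where "w = f v - l *\<^sub>R v"
  define c where "c = w \<bullet> f w - l * (w \<bullet> w)"
  have vS: "v \<in> S" and nv: "norm v = 1" using v by auto
  have wS: "w \<in> S"
    unfolding w_def using inv vS S by (intro subspace_diff subspace_scale) auto
  \<comment> \<open>The residual \<open>w\<close> is the direction in which the nonnegative form
    \<open>x \<bullet> f x - l * (x \<bullet> x)\<close>, which vanishes at \<open>v\<close>, has slope \<open>2 * (w \<bullet> w)\<close>.\<close>
  have quad: "0 \<le> 2 * t * (w \<bullet> w) + t\<^sup>2 * c" for t
  proof -
    let ?x = "v + t *\<^sub>R w"
    have "?x \<in> S" using vS wS S by (intro subspace_add subspace_scale)
    from ge[OF this] have "0 \<le> ?x \<bullet> f ?x - l * (?x \<bullet> ?x)" by simp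
    also have "\<dots> = (v \<bullet> f v - l * (v \<bullet> v)) + 2 * t * (w \<bullet> f v - l * (w \<bullet> v)) + t\<^sup>2 * c"
      using sa[of v w]
      by (simp add: f.add f.scaleR inner_simps c_def power2_eq_square algebra_simps inner_commute)
    also have "v \<bullet> f v - l * (v \<bullet> v) = 0"
      using nv by (simp add: l_def dot_square_norm)
    also have "w \<bullet> f v - l * (w \<bullet> v) = w \<bullet> w"
      by (simp add: w_def inner_simps)
    finally show ?thesis by simp
  qed
  have c: "0 \<le> c" using ge[OF wS] by (simp add: c_def)
  have "w \<bullet> w = 0"
  proof (rule ccontr)
    assume "w \<bullet> w \<noteq> 0"
    define q where "q = w \<bullet> w / (c + 1)"
    have w: "w \<bullet> w = q * (c + 1)" and q: "q \<noteq> 0"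
      using \<open>w \<bullet> w \<noteq> 0\<close> c by (auto simp: q_def)
    have "0 \<le> 2 * (- q) * (q * (c + 1)) + (- q)\<^sup>2 * c"
      using quad[of "- q"] by (simp only: w)
    also have "\<dots> = - (q\<^sup>2 * (c + 2))"
      by (simp add: power2_eq_square algebra_simps)
    also have "\<dots> < 0" using q c by simp
    finally show False by simp
  qed
  then have "f v = l *\<^sub>R v" by (simp add: w_def)
  then show thesis using that vS nv ge by blast
qed

text \<open>
  Split off one eigenvector; the orthogonal complement within \<open>S\<close> is invariant again because the map
  is self-adjoint.
\<close>

lemma selfadjoint_orthonormal_eigenbasis:
  fixes f :: "'a::euclidean_space \<Rightarrow> 'a"
  assumes lin: "linear f" and sa: "\<And>x y. f x \<bullet> y = x \<bullet> f y"
    and "subspace S" "f ` S \<subseteq> S"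
  shows "\<exists>B. B \<subseteq> S \<and> span B = S \<and> pairwise orthogonal B
    \<and> (\<forall>v\<in>B. norm v = 1 \<and> (\<exists>l. f v = l *\<^sub>R v))"
  using assms(3,4)
proof (induction "dim S" arbitrary: S rule: less_induct)
  case less
  show ?case
  proof (cases "S = {0}")
    case True
    then show ?thesis by (intro exI[of _ "{}"]) simp
  next
    case False
    interpret f: linear f by (rule lin)
    obtain v l where v: "v \<in> S" "norm v = 1" "f v = l *\<^sub>R v"
      using selfadjoint_min_eigenvector[OF lin sa less.prems(1) False less.prems(2)] by metis
    define T where "T = S \<inter> {x. v \<bullet> x = 0}"
    have T: "subspace T"
      unfolding T_def using less.prems(1) by (intro subspace_inter subspace_hyperplane)
    have "v \<notin> T" using v by (auto simp: T_def)
    then have "span T \<subset> span S"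
      using T less.prems(1) v(1) by (metis Int_lower1 T_def psubsetI span_eq_iff)
    then have "dim T < dim S" by (rule dim_psubset)
    moreover have "f ` T \<subseteq> T"
      using less.prems(2) sa[of v, symmetric] v(3) by (auto simp: T_def)
    ultimately obtain B where B: "B \<subseteq> T" "span B = T" "pairwise orthogonal B"
      "\<forall>v\<in>B. norm v = 1 \<and> (\<exists>l. f v = l *\<^sub>R v)"
      using less.hyps[of T] T by metis
    have "x \<in> span (insert v B)" if "x \<in> S" for x
    proof -
      have "x - (v \<bullet> x) *\<^sub>R v \<in> T"
        using that v less.prems(1)
        by (auto simp: T_def inner_simps dot_square_norm intro!: subspace_diff subspace_scale)
      then show ?thesis using B(2) by (auto simp: span_insert)
    qed
    moreover have "insert v B \<subseteq> S" using v(1) B(1) by (auto simp: T_def)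
    ultimately have "span (insert v B) = S"
      using less.prems(1) by (metis subsetI subset_antisym span_minimal)
    moreover have "pairwise orthogonal (insert v B)"
      using B(1,3) by (auto simp: pairwise_insert T_def orthogonal_def inner_commute)
    ultimately show ?thesis
      using B(4) v \<open>insert v B \<subseteq> S\<close> by (intro exI[of _ "insert v B"]) auto
  qed
qed

text \<open>
  The basis is indexed by the index type of the matrix, so that it can be read as an orthogonal
  matrix whose columns diagonalise \<open>M\<close>.
\<close>

definition eigenbasis :: "real^'m^'m \<Rightarrow> ('m \<Rightarrow> real^'m) \<Rightarrow> ('m \<Rightarrow> real) \<Rightarrow> bool" where
  "eigenbasis M b l \<longleftrightarrow>
    (\<forall>i j. b i \<bullet> b j = (if i = j then 1 else 0)) \<and> (\<forall>i. M *v b i = l i *\<^sub>R b i)"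

lemma inner_matrix_vector_transpose:
  fixes M :: "real^'n^'m"
  shows "(M *v x) \<bullet> y = x \<bullet> (transpose M *v y)"
  by (metis dot_lmul_matrix inner_commute transpose_matrix_vector)

lemma symmetric_eigenbasis_exists:
  fixes M :: "real^'m^'m"
  assumes "transpose M = M"
  shows "\<exists>b l. eigenbasis M b l"
proof -
  have sa: "(M *v x) \<bullet> y = x \<bullet> (M *v y)" for x y
    using inner_matrix_vector_transpose[of M x y] assms by simp
  obtain B where B: "span B = UNIV" "pairwise orthogonal B"
    "\<forall>v\<in>B. norm v = 1 \<and> (\<exists>l. M *v v = l *\<^sub>R v)"
    using selfadjoint_orthonormal_eigenbasis[OF matrix_vector_mul_linear[of M] sa subspace_UNIV]
    by auto
  have "independent B"
    using B(2,3) pairwise_orthogonal_independent by fastforce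
  then have "card B = CARD('m)" "finite B"
    using B(1) dim_eq_card_independent[of B] dim_span[of B] independent_imp_finite
    by (auto simp: dim_UNIV)
  then obtain b where b: "bij_betw b (UNIV :: 'm set) B"
    by (metis finite_same_card_bij finite)
  then have bB: "b i \<in> B" for i by (auto simp: bij_betw_def)
  then have "\<forall>i. \<exists>l. M *v b i = l *\<^sub>R b i" using B(3) by blast
  from choice[OF this] obtain l where l: "\<forall>i. M *v b i = l i *\<^sub>R b i" ..
  have "b i \<bullet> b j = (if i = j then 1 else 0)" for i j
  proof (cases "i = j")
    case True
    then show ?thesis using B(3) bB[of j] by (simp add: dot_square_norm)
  next
    case False
    then have "b i \<noteq> b j"
      using b by (metis UNIV_I bij_betw_inv_into_left)
    then show ?thesis
      using B(2) bB[of i] bB[of j] False by (simp add: pairwise_def orthogonal_def)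
  qed
  then show ?thesis using l unfolding eigenbasis_def by blast
qed

text \<open>
  Conjugating by the matrix with columns \<open>b\<close> turns the characteristic polynomial into the product
  of the factors \<open>x - l i\<close>. This ties the algebraic multiplicities in \<^const>\<open>eigenvalues\<close> to
  the number of basis vectors.
\<close>

lemma eigenvalues_eigenbasis:
  fixes M :: "real^'m^'m"
  assumes "eigenbasis M b l"
  shows "eigenvalues M = image_mset l (mset_set UNIV)"
proof -
  have b: "b i \<bullet> b j = (if i = j then 1 else 0)" "M *v b i = l i *\<^sub>R b i" for i j
    using assms by (auto simp: eigenbasis_def)
  define P :: "real^'m^'m" where "P = (\<chi> i j. b j $ i)"
  have "transpose P ** P = mat 1"
    using b(1) by (simp add: P_def matrix_matrix_mult_def transpose_def mat_def vec_eq_iff inner_vec_def)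
  then have detP: "det P \<noteq> 0"
    by (metis det_mul det_I mult_zero_right zero_neq_one)
  have "poly (charpoly M) x = poly (\<Prod>i\<in>UNIV. [:- l i, 1:]) x" for x
  proof -
    define E :: "real^'m^'m" where "E = (\<chi> i j. if i = j then x - l i else 0)"
    have mx: "mat x *v v = x *\<^sub>R v" for v :: "real^'m"
      by (simp add: vec_eq_iff matrix_vector_mult_def mat_def if_distrib[of "\<lambda>c. c * _"] cong: if_cong)
    have "((mat x - M) ** P) $ i $ j = (P ** E) $ i $ j" for i j
    proof -
      have "((mat x - M) ** P) $ i $ j = ((mat x - M) *v b j) $ i"
        by (simp add: P_def matrix_matrix_mult_def matrix_vector_mult_def)
      also have "\<dots> = (x - l j) * b j $ i"
        by (simp add: matrix_vector_mult_diff_rdistrib b(2) mx algebra_simps)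
      also have "\<dots> = (P ** E) $ i $ j"
        by (simp add: matrix_matrix_mult_def E_def P_def if_distrib[of "\<lambda>c. _ * c"] cong: if_cong)
      finally show ?thesis .
    qed
    then have "(mat x - M) ** P = P ** E" by (simp add: vec_eq_iff)
    then have "det (mat x - M) * det P = det P * det E"
      by (metis det_mul)
    moreover have "det E = (\<Prod>i\<in>UNIV. x - l i)"
      by (subst det_diagonal) (simp_all add: E_def)
    ultimately show ?thesis
      using detP by (simp add: poly_charpoly poly_prod)
  qed
  then have "charpoly M = (\<Prod>i\<in>UNIV. [:- l i, 1:])"
    by (metis poly_eq_poly_eq_iff ext)
  then have "eigenvalues M = (\<Sum>i\<in>UNIV. {#l i#})"
    unfolding eigenvalues_def by (subst \<open>charpoly M = _\<close>, subst proots_prod) simp_all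
  also have "\<dots> = image_mset l (mset_set UNIV)"
    by (simp add: sum_unfold_sum_mset)
  finally show ?thesis .
qed

section \<open>Inertia\<close>

lemma num_pos_eigenvalues_eigenbasis:
  assumes "eigenbasis M b l"
  shows "num_pos_eigenvalues M = card {i. l i > 0}"
  by (simp add: num_pos_eigenvalues_def eigenvalues_eigenbasis[OF assms] filter_mset_image_mset)

lemma num_neg_eigenvalues_eigenbasis:
  assumes "eigenbasis M b l"
  shows "num_neg_eigenvalues M = card {i. l i < 0}"
  by (simp add: num_neg_eigenvalues_def eigenvalues_eigenbasis[OF assms] filter_mset_image_mset)

lemma matrix_vector_mult_uminus:
  fixes M :: "'a::ring_1^'n^'m"
  shows "(- M) *v x = - (M *v x)"
  by (simp add: vec_eq_iff matrix_vector_mult_def sum_negf)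

lemma num_pos_eigenvalues_uminus:
  assumes "transpose M = M"
  shows "num_pos_eigenvalues (- M) = num_neg_eigenvalues M"
proof -
  obtain b l where bl: "eigenbasis M b l"
    using symmetric_eigenbasis_exists[OF assms] by blast
  then have "eigenbasis (- M) b (\<lambda>i. - l i)"
    by (simp add: eigenbasis_def matrix_vector_mult_uminus)
  with bl show ?thesis
    by (simp add: num_pos_eigenvalues_eigenbasis num_neg_eigenvalues_eigenbasis)
qed

lemma num_pos_plus_num_neg_le:
  fixes M :: "real^'m^'m"
  assumes "transpose M = M"
  shows "num_pos_eigenvalues M + num_neg_eigenvalues M \<le> CARD('m)"
proof -
  obtain b l where bl: "eigenbasis M b l"
    using symmetric_eigenbasis_exists[OF assms] by blast
  have "card {i. l i > 0} + card {i. l i < 0} = card ({i. l i > 0} \<union> {i. l i < 0})"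
    by (subst card_Un_disjoint) auto
  also have "\<dots> \<le> CARD('m)" by (simp add: card_mono)
  finally show ?thesis
    using bl by (simp add: num_pos_eigenvalues_eigenbasis num_neg_eigenvalues_eigenbasis)
qed

text \<open>
  A subspace on which the form is positive meets the span of the eigenvectors with eigenvalue at
  most zero only in the origin, so the two dimensions add up to at most that of the whole space.
\<close>

lemma dim_positive_subspace_le:
  fixes M :: "real^'m^'m"
  assumes sym: "transpose M = M" and W: "subspace W"
    and pos: "\<And>x. x \<in> W \<Longrightarrow> x \<noteq> 0 \<Longrightarrow> x \<bullet> (M *v x) > 0"
  shows "dim W \<le> num_pos_eigenvalues M"
proof -
  obtain b l where bl: "eigenbasis M b l"
    using symmetric_eigenbasis_exists[OF sym] by blast
  then have b: "b i \<bullet> b j = (if i = j then 1 else 0)" "M *v b i = l i *\<^sub>R b i" for i j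
    by (auto simp: eigenbasis_def)
  let ?J = "{i. \<not> l i > 0}"
  let ?N = "span (b ` ?J)"
  have inj: "inj b"
    using b(1) by (metis (full_types) injI zero_neq_one)
  have "independent (b ` ?J)"
  proof (rule pairwise_orthogonal_independent)
    show "pairwise orthogonal (b ` ?J)"
      using b(1) by (auto simp: pairwise_def orthogonal_def)
    show "0 \<notin> b ` ?J"
      using b(1) by (metis imageE inner_zero_left zero_neq_one)
  qed
  then have dimN: "dim ?N = card ?J"
    using inj by (simp add: dim_eq_card_independent card_image inj_on_subset)
  have "x \<bullet> (M *v x) \<le> 0" if xN: "x \<in> ?N" for x
  proof -
    obtain c where x: "x = (\<Sum>i\<in>?J. c i *\<^sub>R b i)"
    proof -
      obtain u where "x = (\<Sum>v\<in>b ` ?J. u v *\<^sub>R v)"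
        using xN by (auto simp: span_finite)
      then show thesis
        using inj that[of "u \<circ> b"] by (simp add: sum.reindex inj_on_subset)
    qed
    have "M *v x = (\<Sum>i\<in>?J. (c i * l i) *\<^sub>R b i)"
      unfolding x by (simp add: linear_sum[OF matrix_vector_mul_linear] b(2) matrix_vector_mult_scaleR)
    moreover have "x \<bullet> b j = c j" if "j \<in> ?J" for j
      using that unfolding x
      by (simp add: inner_sum_left b(1) if_distrib[of "\<lambda>c. _ * c"] cong: if_cong)
    ultimately have "x \<bullet> (M *v x) = (\<Sum>i\<in>?J. c i * c i * l i)"
      by (simp add: inner_sum_right mult.commute mult.left_commute)
    also have "\<dots> \<le> 0"
      by (intro sum_nonpos mult_nonneg_nonpos) auto
    finally show ?thesis .
  qed
  then have "x = 0" if "x \<in> W" "x \<in> ?N" for x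
    using pos[OF that(1)] that(2) by (meson not_less)
  then have "W \<inter> ?N = {0}"
    using subspace_0[OF W] span_zero[of "b ` ?J"] by blast
  then have "dim (W \<inter> ?N) = 0" by simp
  then have "dim W + card ?J = dim {x + y |x y. x \<in> W \<and> y \<in> ?N}"
    using dim_sums_Int[OF W subspace_span, of "b ` ?J"] dimN by linarith
  also have "\<dots> \<le> CARD('m)"
    using dim_subset_UNIV[of "{x + y |x y. x \<in> W \<and> y \<in> ?N}"] by simp
  also have "\<dots> = card {i. l i > 0} + card ?J"
  proof -
    have "card ({i. l i > 0} \<union> ?J) = card {i. l i > 0} + card ?J"
      by (rule card_Un_disjoint) auto
    moreover have "{i. l i > 0} \<union> ?J = UNIV" by blast
    ultimately show ?thesis by simp
  qed
  finally show ?thesis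
    by (simp add: num_pos_eigenvalues_eigenbasis[OF bl])
qed

section \<open>The bordered matrix on a space of dimension \<open>n + 1\<close>\<close>

definition join :: "real^'n \<Rightarrow> real^'m \<Rightarrow> real^('n + 'm)" where
  "join u w = (\<chi> i. case i of Inl k \<Rightarrow> u $ k | Inr k \<Rightarrow> w $ k)"

lemma sum_UNIV_sum_type:
  fixes g :: "'a::finite + 'b::finite \<Rightarrow> 'c::comm_monoid_add"
  shows "sum g UNIV = (\<Sum>i\<in>UNIV. g (Inl i)) + (\<Sum>i\<in>UNIV. g (Inr i))"
  by (simp add: UNIV_Plus_UNIV[symmetric] sum.Plus o_def del: UNIV_Plus_UNIV)

lemma inner_join: "join u w \<bullet> join u' w' = u \<bullet> u' + w \<bullet> w'"
  by (simp add: inner_vec_def join_def sum_UNIV_sum_type)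

lemma bar_matrix_join: "bar_matrix A *v join u w = join (transpose A *v w) (A *v u)"
  by (simp add: vec_eq_iff matrix_vector_mult_def bar_matrix_def block_matrix_def join_def
      sum_UNIV_sum_type del: transpose_matrix_vector split: sum.split)

lemma linear_join:
  assumes "linear f" "linear g"
  shows "linear (\<lambda>z. join (f z) (g z))"
  using assms
  by (simp add: linear_iff join_def vec_eq_iff split: sum.split)

lemma bar_matrix_form:
  "join u w \<bullet> (bar_matrix A *v join u w) = 2 * (w \<bullet> (A *v u))"
  using inner_matrix_vector_transpose[of A u w]
  by (simp add: bar_matrix_join inner_join inner_commute del: transpose_matrix_vector)

text \<open>
  For \<open>\<sigma> > 0\<close> the vector \<open>y\<close> is the normalised image of \<open>v\<close>. For \<open>\<sigma> = 0\<close> the vectors \<open>v\<close> and \<open>y\<close> are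
  unrelated kernel vectors of \<open>A\<close> and of its transpose. Stating both cases by the same two equations
  avoids a separate treatment of singular matrices below.
\<close>

lemma singular_pair_exists:
  fixes A :: "real^'n^'n"
  assumes "\<sigma> \<in># singular_values A"
  obtains v y where "norm v = 1" "norm y = 1" "0 \<le> \<sigma>"
    "A *v v = \<sigma> *\<^sub>R y" "transpose A *v y = \<sigma> *\<^sub>R v"
proof -
  obtain s u where s: "\<sigma> = sqrt s" and u: "u \<noteq> 0" "(transpose A ** A) *v u = s *\<^sub>R u"
    using assms by (auto simp: singular_values_def in_eigenvalues_iff)
  define v where "v = u /\<^sub>R norm u"
  have nv: "norm v = 1" using u(1) by (simp add: v_def)
  have eig: "transpose A *v (A *v v) = s *\<^sub>R v"
    using u(2) by (simp add: v_def matrix_vector_mul_assoc matrix_vector_mult_scaleR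
        scaleR_left_commute del: transpose_matrix_vector)
  have "(A *v v) \<bullet> (A *v v) = s"
    by (simp only: inner_matrix_vector_transpose eig) (simp add: nv dot_square_norm)
  then have s0: "0 \<le> s" and nAv: "norm (A *v v) = \<sigma>"
    by (metis inner_ge_zero, simp add: s norm_eq_sqrt_inner)
  have \<sigma>: "0 \<le> \<sigma>" "\<sigma> * \<sigma> = s" using s0 by (simp_all add: s)
  show thesis
  proof (cases "\<sigma> = 0")
    case False
    define y where "y = A *v v /\<^sub>R \<sigma>"
    have "transpose A *v y = (s / \<sigma>) *\<^sub>R v"
      by (simp add: y_def matrix_vector_mult_scaleR eig divide_inverse_commute del: transpose_matrix_vector)
    also have "s / \<sigma> = \<sigma>" using False \<sigma>(2) by (metis nonzero_mult_div_cancel_left)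
    finally have "transpose A *v y = \<sigma> *\<^sub>R v" .
    moreover have "norm y = 1" "A *v v = \<sigma> *\<^sub>R y"
      using False \<sigma>(1) nAv by (simp_all add: y_def)
    ultimately show thesis using that nv \<sigma>(1) by blast
  next
    case True
    \<comment> \<open>A square matrix with a kernel has a transpose with a kernel.\<close>
    have "A *v v = 0" using nAv True by simp
    then have "\<not> invertible A"
      using nv by (auto simp: invertible_left_inverse matrix_left_invertible_ker)
    then have "\<not> invertible (transpose A)"
      by (simp add: invertible_det_nz)
    then obtain x where x: "x \<noteq> 0" "transpose A *v x = 0"
      by (auto simp: invertible_left_inverse matrix_left_invertible_ker simp del: transpose_matrix_vector)
    show thesis
      using that[of v "x /\<^sub>R norm x"] nv x True \<open>A *v v = 0\<close>
      by (simp add: matrix_vector_mult_scaleR del: transpose_matrix_vector)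
  qed
qed

text \<open>
  This is where the space of dimension \<open>n + 1\<close> comes from. On the graph of \<open>A\<close> the form of the
  bordered matrix is \<open>2 * (norm (A *v u))\<^sup>2\<close>, hence nonnegative. Adding the one direction
  \<open>(0, y)\<close> costs at most \<open>\<sigma>\<close>: with respect to the splitting of \<open>u\<close> along and across \<open>v\<close>, the vector
  decomposes orthogonally into \<open>(u', A *v u')\<close> and \<open>(a *\<^sub>R v, g *\<^sub>R y)\<close>, the singular pair equations
  make the cross terms vanish, and on the second part the form is \<open>2 * \<sigma> * a * g\<close>, which is at least
  \<open>- \<sigma> * (a\<^sup>2 + g\<^sup>2)\<close>.
\<close>

lemma bar_matrix_form_ge:
  fixes A :: "real^'n^'n"
  assumes y: "norm y = 1" and v: "norm v = 1" and \<sigma>: "0 \<le> \<sigma>"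
    and Av: "A *v v = \<sigma> *\<^sub>R y" and Ay: "transpose A *v y = \<sigma> *\<^sub>R v"
  defines "x \<equiv> (\<lambda>u b. join u (A *v u + b *\<^sub>R y))"
  shows "x u b \<bullet> (bar_matrix A *v x u b) \<ge> - \<sigma> * (x u b \<bullet> x u b)"
proof -
  define a where "a = v \<bullet> u"
  define u' where "u' = u - a *\<^sub>R v"
  define g where "g = b + a * \<sigma>"
  have u: "u = u' + a *\<^sub>R v" by (simp add: u'_def)
  have vv: "v \<bullet> v = 1" "y \<bullet> y = 1" using v y by (simp_all add: dot_square_norm)
  have vu: "v \<bullet> u' = 0" by (simp add: u'_def a_def inner_simps vv)
  define p where "p = A *v u'"
  have yp: "y \<bullet> p = 0"
    using inner_matrix_vector_transpose[of A u' y] vu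
    by (simp add: p_def Ay inner_commute[of y] inner_commute[of u' v] del: transpose_matrix_vector)
  have Au: "A *v u = p + (a * \<sigma>) *\<^sub>R y"
    unfolding u by (simp add: matrix_vector_right_distrib matrix_vector_mult_scaleR Av p_def)
  have w: "A *v u + b *\<^sub>R y = p + g *\<^sub>R y"
    by (simp add: Au g_def scaleR_add_left)
  have form: "x u b \<bullet> (bar_matrix A *v x u b) = 2 * (p \<bullet> p + g * a * \<sigma>)"
    unfolding x_def bar_matrix_form w unfolding Au
    using yp by (simp add: inner_simps vv inner_commute[of p y])
  have "x u b = join (u' + a *\<^sub>R v) (p + g *\<^sub>R y)"
    unfolding x_def w by (subst u) (rule refl)
  then have "x u b \<bullet> x u b = u' \<bullet> u' + a\<^sup>2 + (p \<bullet> p + g\<^sup>2)"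
    using yp vu
    by (simp add: inner_join inner_simps vv inner_commute[of p y] inner_commute[of u' v]
        power2_eq_square)
  then have "x u b \<bullet> (bar_matrix A *v x u b) + \<sigma> * (x u b \<bullet> x u b)
      = (2 + \<sigma>) * (p \<bullet> p) + \<sigma> * (u' \<bullet> u') + \<sigma> * (a + g)\<^sup>2"
    by (simp add: form power2_eq_square algebra_simps)
  also have "\<dots> \<ge> 0" using \<sigma> by simp
  finally show ?thesis by simp
qed

lemma inner_le_spectral_norm:
  fixes M :: "real^'n^'n"
  shows "x \<bullet> (M *v x) \<le> spectral_norm M * (x \<bullet> x)"
proof -
  have "x \<bullet> (M *v x) \<le> norm x * norm (M *v x)" by (rule norm_cauchy_schwarz)
  also have "\<dots> \<le> norm x * (spectral_norm M * norm x)"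
    unfolding spectral_norm_def
    by (intro mult_left_mono onorm matrix_vector_mul_bounded_linear norm_ge_zero)
  finally show ?thesis by (simp add: dot_square_norm power2_eq_square mult_ac)
qed

text \<open>
  If \<open>\<sigma> < \<theta> - \<rho>\<close>, then on the space of \<open>bar_matrix_form_ge\<close> the shifted form exceeds \<open>\<rho> * (x \<bullet> x)\<close>,
  which bounds the contribution of the error matrix. Hence the form of \<open>L ** D ** transpose L\<close> is
  positive there. Consequently \<open>transpose L\<close> is injective on that space and \<open>D\<close> is positive on its
  image, which gives \<open>D\<close> more than \<open>n\<close> positive eigenvalues.
\<close>

lemma singular_value_ge:
  fixes A :: "real^'n^'n" and L D :: "real^('n + 'n)^('n + 'n)"
  assumes sym: "transpose D = D"
    and \<rho>: "\<rho> \<ge> spectral_norm (bar_matrix A + \<theta> *\<^sub>R mat 1 - L ** D ** transpose L)"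
    and npos: "num_pos_eigenvalues D \<le> CARD('n)"
    and \<sigma>: "\<sigma> \<in># singular_values A"
  shows "\<sigma> \<ge> \<theta> - \<rho>"
proof (rule ccontr)
  assume less: "\<not> \<sigma> \<ge> \<theta> - \<rho>"
  obtain v y where vy: "norm v = 1" "norm y = 1" "0 \<le> \<sigma>"
    "A *v v = \<sigma> *\<^sub>R y" "transpose A *v y = \<sigma> *\<^sub>R v"
    using singular_pair_exists[OF \<sigma>] by metis
  define x :: "(real^'n) \<times> real \<Rightarrow> real^('n + 'n)"
    where "x = (\<lambda>z. join (fst z) (A *v fst z + snd z *\<^sub>R y))"
  have linx: "linear x"
    unfolding x_def
    by (intro linear_join) (auto simp: linear_iff algebra_simps matrix_vector_right_distrib)
  have xpos: "x z \<bullet> x z > 0" if "z \<noteq> 0" for z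
  proof -
    have "fst z \<noteq> 0 \<or> A *v fst z + snd z *\<^sub>R y \<noteq> 0"
      using that vy(2) by (cases z) (auto simp: zero_prod_def)
    then have "fst z \<bullet> fst z > 0 \<or> (A *v fst z + snd z *\<^sub>R y) \<bullet> (A *v fst z + snd z *\<^sub>R y) > 0"
      by simp
    then show ?thesis
      unfolding x_def inner_join
      by (meson add_nonneg_pos add_pos_nonneg inner_ge_zero)
  qed
  let ?E = "bar_matrix A + \<theta> *\<^sub>R mat 1 - L ** D ** transpose L"
  define f where "f = (\<lambda>z. transpose L *v x z)"
  have linf: "linear f"
    unfolding f_def using linear_compose[OF linx matrix_vector_mul_linear[of "transpose L"]]
    by (simp add: o_def del: transpose_matrix_vector)
  have fpos: "f z \<bullet> (D *v f z) > 0" if "z \<noteq> 0" for z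
  proof -
    let ?x = "x z"
    have "?x \<bullet> ((L ** D ** transpose L) *v ?x) = f z \<bullet> (D *v f z)"
      by (simp add: f_def inner_matrix_vector_transpose transpose_transpose
          matrix_vector_mul_assoc matrix_mul_assoc del: transpose_matrix_vector)
    moreover have "?x \<bullet> (?E *v ?x) = ?x \<bullet> (bar_matrix A *v ?x) + \<theta> * (?x \<bullet> ?x)
        - ?x \<bullet> ((L ** D ** transpose L) *v ?x)"
      by (simp add: matrix_vector_mult_diff_rdistrib matrix_vector_mult_add_rdistrib
          scaleR_matrix_vector_assoc[symmetric] inner_simps)
    moreover have "?x \<bullet> (?E *v ?x) \<le> \<rho> * (?x \<bullet> ?x)"
      using inner_le_spectral_norm[of ?x ?E] mult_right_mono[OF \<rho>, of "?x \<bullet> ?x"] by simp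
    moreover have "?x \<bullet> (bar_matrix A *v ?x) \<ge> - \<sigma> * (?x \<bullet> ?x)"
      unfolding x_def using bar_matrix_form_ge[OF vy(2,1,3-5)] by simp
    moreover have "(\<theta> - \<rho> - \<sigma>) * (?x \<bullet> ?x) > 0"
      using less xpos[OF that] by simp
    ultimately show ?thesis by (simp add: algebra_simps)
  qed
  have "inj f"
    using fpos by (subst linear_injective_0[OF linf]) fastforce
  then have "dim (range f) = CARD('n) + 1"
    using dim_image_eq[OF linf, of UNIV] by (simp add: inj_on_subset)
  moreover have "dim (range f) \<le> num_pos_eigenvalues D"
  proof (rule dim_positive_subspace_le[OF sym])
    show "subspace (range f)" using linear_subspace_image[OF linf subspace_UNIV] .
    show "w \<bullet> (D *v w) > 0" if w: "w \<in> range f" "w \<noteq> 0" for w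
      using w fpos linear_0[OF linf] by (metis imageE)
  qed
  ultimately show False using npos by simp
qed

section \<open>The smallest singular value and the inverse\<close>

text \<open>
  The minimal Rayleigh quotient of \<open>transpose A ** A\<close> is an eigenvalue, so its square root is
  a singular value and at the same time a lower bound for the expansion of \<open>A\<close>.
\<close>

lemma least_singular_value:
  fixes A :: "real^'n^'n"
  obtains \<sigma> where "\<sigma> \<in># singular_values A" "\<And>x. \<sigma> * norm x \<le> norm (A *v x)"
proof -
  let ?G = "transpose A ** A"
  have form: "x \<bullet> (?G *v x) = (norm (A *v x))\<^sup>2" for x
    by (simp only: matrix_vector_mul_assoc[symmetric] inner_matrix_vector_transpose[symmetric]
        dot_square_norm)
  have sa: "(?G *v x) \<bullet> y = x \<bullet> (?G *v y)" for x y
    using inner_matrix_vector_transpose[of ?G x y]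
    by (simp add: matrix_transpose_mul transpose_transpose del: transpose_matrix_vector)
  have "(UNIV :: (real^'n) set) \<noteq> {0}"
    using UNIV_not_singleton by blast
  then obtain v s where v: "norm v = 1" "?G *v v = s *\<^sub>R v" and ge: "\<And>x. s * (x \<bullet> x) \<le> x \<bullet> (?G *v x)"
    using selfadjoint_min_eigenvector[OF matrix_vector_mul_linear[of ?G] sa subspace_UNIV]
    by (metis UNIV_I subset_UNIV)
  have "v \<noteq> 0" using v(1) by auto
  then have "s \<in># eigenvalues ?G"
    unfolding in_eigenvalues_iff using v(2) by blast
  then have "sqrt s \<in># singular_values A"
    by (simp add: singular_values_def)
  moreover have "sqrt s * norm x \<le> norm (A *v x)" for x
  proof -
    have "sqrt s * norm x = sqrt (s * (x \<bullet> x))"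
      by (simp add: real_sqrt_mult norm_eq_sqrt_inner)
    also have "\<dots> \<le> sqrt ((norm (A *v x))\<^sup>2)"
      using ge[of x] unfolding form by (rule real_sqrt_le_mono)
    finally show ?thesis by simp
  qed
  ultimately show thesis by (rule that)
qed

lemma inverse_spectral_norm_le:
  fixes A :: "real^'n^'n"
  assumes c: "0 < c" and lower: "\<And>x. c * norm x \<le> norm (A *v x)"
  shows "invertible A \<and> spectral_norm (matrix_inv A) \<le> 1 / c"
proof
  have "x = 0" if "A *v x = 0" for x
    using lower[of x] c that by (simp add: mult_le_0_iff)
  then show inv: "invertible A"
    by (auto simp: invertible_left_inverse matrix_left_invertible_ker)
  then have right: "A ** matrix_inv A = mat 1"
    unfolding matrix_inv_def invertible_def by (metis (mono_tags, lifting) someI_ex)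
  have "norm (matrix_inv A *v x) \<le> 1 / c * norm x" for x
    using lower[of "matrix_inv A *v x"] c
    by (simp add: matrix_vector_mul_assoc right field_simps)
  then show "spectral_norm (matrix_inv A) \<le> 1 / c"
    unfolding spectral_norm_def by (rule onorm_le)
qed

theorem lemma1:
  fixes A :: "real^'n^'n"
    and L D :: "real^('n + 'n)^('n + 'n)"
    and \<theta> \<rho> :: real
  assumes "transpose D = D"
    and "\<rho> \<ge> spectral_norm (bar_matrix A + \<theta> *\<^sub>R mat 1 - L ** D ** transpose L)"
    and "num_pos_eigenvalues D = CARD('n) \<or> num_neg_eigenvalues D = CARD('n)"
  shows "sigma_min A \<ge> \<bar>\<theta>\<bar> - \<rho> \<and>
    (\<bar>\<theta>\<bar> > \<rho> \<longrightarrow>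
      invertible A \<and> spectral_norm (matrix_inv A) \<le> 1 / (\<bar>\<theta>\<bar> - \<rho>))"
proof -
  \<comment> \<open>Either alternative of the inertia hypothesis bounds both counts by \<open>n\<close>, because together
    they are at most \<open>2 * n\<close>. The sign of \<open>\<theta>\<close> therefore need not match the alternative.\<close>
  have npos: "num_pos_eigenvalues D \<le> CARD('n)" and nneg: "num_neg_eigenvalues D \<le> CARD('n)"
    using assms(3) num_pos_plus_num_neg_le[OF assms(1)] by auto
  \<comment> \<open>Changing the signs of \<open>A\<close>, \<open>\<theta>\<close> and \<open>D\<close> preserves the singular values and the error norm,
    exchanges the two inertia counts, and turns the bound for \<open>\<theta>\<close> into the bound for \<open>- \<theta>\<close>.\<close>
  have symm: "transpose (- D) = - D"
    using assms(1) by (simp add: transpose_def vec_eq_iff)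
  have sv: "singular_values (- A) = singular_values A"
  proof -
    have "transpose (- A) ** (- A) = transpose A ** A"
      by (simp add: transpose_def matrix_matrix_mult_def)
    then show ?thesis by (simp add: singular_values_def)
  qed
  have "bar_matrix (- A) + (- \<theta>) *\<^sub>R mat 1 - L ** (- D) ** transpose L
      = - (bar_matrix A + \<theta> *\<^sub>R mat 1 - L ** D ** transpose L)"
  proof -
    have "bar_matrix (- A) = - bar_matrix A"
      by (simp add: bar_matrix_def block_matrix_def transpose_def vec_eq_iff split: sum.split)
    moreover have "L ** (- D) ** transpose L = - (L ** D ** transpose L)"
      by (simp add: matrix_matrix_mult_def vec_eq_iff sum_negf)
    ultimately show ?thesis by simp
  qed
  then have \<rho>': "\<rho> \<ge> spectral_norm (bar_matrix (- A) + (- \<theta>) *\<^sub>R mat 1 - L ** (- D) ** transpose L)"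
    using assms(2) by (simp only: spectral_norm_def matrix_vector_mult_uminus onorm_neg)
  have "\<sigma> \<ge> \<bar>\<theta>\<bar> - \<rho>" if "\<sigma> \<in># singular_values A" for \<sigma>
  proof -
    have "\<sigma> \<ge> \<theta> - \<rho>"
      by (rule singular_value_ge[OF assms(1,2) npos that])
    moreover have "\<sigma> \<ge> - \<theta> - \<rho>"
      using nneg that
      by (intro singular_value_ge[OF symm \<rho>']) (simp_all add: num_pos_eigenvalues_uminus[OF assms(1)] sv)
    ultimately show ?thesis by (simp add: abs_if)
  qed
  moreover obtain \<tau> where \<tau>: "\<tau> \<in># singular_values A" "\<And>x. \<tau> * norm x \<le> norm (A *v x)"
    using least_singular_value[of A] by metis
  ultimately have min: "sigma_min A \<ge> \<bar>\<theta>\<bar> - \<rho>" and "\<bar>\<theta>\<bar> - \<rho> \<le> \<tau>"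
    unfolding sigma_min_def by (auto intro!: Min.boundedI)
  then have "(\<bar>\<theta>\<bar> - \<rho>) * norm x \<le> norm (A *v x)" for x
    by (meson \<tau>(2) mult_right_mono norm_ge_zero order_trans)
  then show ?thesis
    using min inverse_spectral_norm_le[of "\<bar>\<theta>\<bar> - \<rho>" A] by simp
qed

end
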